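(* Let $V$ be an $\mathcal{R}^{(2)}$-module, and let $n,m$ be nonnegative integers with $n+m\neq 0$. Then $V$ is isomorphic (as an $\mathcal{R}^{(2)}$-module) to $\mathcal{R}^{(2)n,m}$ if and only if $\dim_{\mathcal{R}^{(2)}}(V)=(n,m)$.
   Context: Let $\mathcal{R}$ be the field of real numbers. The dual real number algebra is the 2-dimensional commutative associative real algebra $\mathcal{R}^{(2)}=\mathcal{R}\oplus\mathcal{R}\,1^{\#}$ with basis $\{1,1^{\#}\}$ and product $(x_1+x_2 1^{\#})(y_1+y_2 1^{\#})=x_1y_1+(x_1y_2+x_2y_1)1^{\#}$ for $x_1,x_2,y_1,y_2\in\mathcal{R}$ (so $1^{\#}1^{\#}=0$); $\mathcal{R}$ is identified with the subalgebra $\mathcal{R}\cdot 1$. For an $\mathcal{R}^{(2)}$-module $V$, put $Ker\,1^{\#}_V:=\{v\in V \mid 1^{\#}v=0\}$. A $(\mathcal{R}^{(2)},\mathcal{R})$-basis for $V$ is a subset $\beta=(S_1\,\|\,S_2):=S_1\cup S_2$ of $V$ (with the decomposition into $S_1$ and $S_2$ being part of the data) such that: (i) $S_1\subseteq V$ and $S_2\subseteq Ker\,1^{\#}_V$; (ii) $\beta$ is $(\mathcal{R}^{(2)}\,\|\,\mathcal{R})$-linearly independent: for any finite families of distinct elements $v_1,\dots,v_s\in S_1$ and distinct elements $w_1,\dots,w_t\in S_2$, and any $c_1,\dots,c_s\in\mathcal{R}^{(2)}$ and $d_1,\dots,d_t\in\mathcal{R}$, the equality $\sum_{i=1}^s c_iv_i+\sum_{j=1}^t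 d_jw_j=0$ implies that all $c_i=0$ and all $d_j=0$; (iii) every $v\in V$ can be written as a finite sum $v=\sum_{i=1}^s c_iv_i+\sum_{j=1}^t d_jw_j$ with $v_i\in S_1$, $w_j\in S_2$, $c_i\in\mathcal{R}^{(2)}$ and $d_j\in\mathcal{R}$. If $V$ has a finite $(\mathcal{R}^{(2)},\mathcal{R})$-basis $(\{v_i\}_{i=1}^n\,\|\,\{v_{n+j}\}_{j=1}^m)$, i.e. one with $|S_1|=n$ and $|S_2|=m$, then $V$ is called finite dimensional; the pair $(n,m)$ of nonnegative integers is unique, is called the $\mathcal{R}^{(2)}$-dimension of $V$, and is denoted $\dim_{\mathcal{R}^{(2)}}(V)=(n,m)$. For nonnegative integers $n,m$ with $n+m\neq 0$, $\mathcal{R}^{(2)n,m}$ is the $\mathcal{R}^{(2)}$-module of all tuples $(x^1,\dots,x^n\,|\,x^{n+1}1^{\#},\dots,x^{n+m}1^{\#})$ with $x^1,\dots,x^n\in\mathcal{R}^{(2)}$ and $x^{n+1},\dots,x^{n+m}\in\mathcal{R}$, with coordinatewise addition and scalar multiplication (superscripts are indices; each of the last $m$ coordinates lies in the ideal $\mathcal{R}1^{\#}$ of $\mathcal{R}^{(2)}$). *)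

theory Defs
  imports Complex_Main "HOL-Algebra.Module"
begin

(* The pair (a, b) encodes a + b 1#. *)

type_synonym dual = "real \<times> real"

definition dual_ring :: "dual ring" where
  "dual_ring =
     \<lparr>carrier = UNIV,
      monoid.mult = (\<lambda>x y. (fst x * fst y, fst x * snd y + snd x * fst y)),
      one = (1, 0),
      zero = (0, 0),
      add = (\<lambda>x y. (fst x + fst y, snd x + snd y))\<rparr>"

definition dual_unit :: dual where
  "dual_unit = (0, 1)"

definition dual_of_real :: "real \<Rightarrow> dual" where
  "dual_of_real a = (a, 0)"

definition ker_dual :: "(dual, 'v, 'x) module_scheme \<Rightarrow> 'v set" where
  "ker_dual V = {v \<in> carrier V. dual_unit \<odot>\<^bsub>V\<^esub> v = \<zero>\<^bsub>V\<^esub>}"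

definition dual_combination ::
  "(dual, 'v, 'x) module_scheme \<Rightarrow> 'v set \<Rightarrow> ('v \<Rightarrow> dual) \<Rightarrow> 'v set \<Rightarrow> ('v \<Rightarrow> real) \<Rightarrow> 'v" where
  "dual_combination V A c B d =
     (\<Oplus>\<^bsub>V\<^esub>v\<in>A. c v \<odot>\<^bsub>V\<^esub> v) \<oplus>\<^bsub>V\<^esub> (\<Oplus>\<^bsub>V\<^esub>w\<in>B. dual_of_real (d w) \<odot>\<^bsub>V\<^esub> w)"

(* Families of distinct vectors are rendered as finite sets A, B with coefficient functions.
   S1 and S2 are not required to be disjoint: for v in both, v + (-1) v = 0 contradicts
   independence. *)

definition dual_independent :: "(dual, 'v, 'x) module_scheme \<Rightarrow> 'v set \<Rightarrow> 'v set \<Rightarrow> bool" where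
  "dual_independent V S1 S2 \<longleftrightarrow>
     (\<forall>A B c d. finite A \<longrightarrow> A \<subseteq> S1 \<longrightarrow> finite B \<longrightarrow> B \<subseteq> S2 \<longrightarrow>
        dual_combination V A c B d = \<zero>\<^bsub>V\<^esub> \<longrightarrow>
        (\<forall>v\<in>A. c v = \<zero>\<^bsub>dual_ring\<^esub>) \<and> (\<forall>w\<in>B. d w = 0))"

definition dual_spanning :: "(dual, 'v, 'x) module_scheme \<Rightarrow> 'v set \<Rightarrow> 'v set \<Rightarrow> bool" where
  "dual_spanning V S1 S2 \<longleftrightarrow>
     (\<forall>v\<in>carrier V. \<exists>A B c d. finite A \<and> A \<subseteq> S1 \<and> finite B \<and> B \<subseteq> S2 \<and>
        v = dual_combination V A c B d)"

definition dual_basis :: "(dual, 'v, 'x) module_scheme \<Rightarrow> 'v set \<Rightarrow> 'v set \<Rightarrow> bool" where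
  "dual_basis V S1 S2 \<longleftrightarrow>
     S1 \<subseteq> carrier V \<and> S2 \<subseteq> ker_dual V \<and> dual_independent V S1 S2 \<and> dual_spanning V S1 S2"

definition dual_finite_dimensional :: "(dual, 'v, 'x) module_scheme \<Rightarrow> bool" where
  "dual_finite_dimensional V \<longleftrightarrow> (\<exists>S1 S2. dual_basis V S1 S2 \<and> finite S1 \<and> finite S2)"

(* Meaningful only for finite dimensional V; otherwise the description denotes an arbitrary pair. *)

definition dual_dim :: "(dual, 'v, 'x) module_scheme \<Rightarrow> nat \<times> nat" where
  "dual_dim V =
     (THE p. \<exists>S1 S2. dual_basis V S1 S2 \<and> finite S1 \<and> finite S2 \<and> p = (card S1, card S2))"

(* Tuples are extensional functions on {1..n+m}. The fields mult and one of the module record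
   are not part of the module structure and are left unspecified. *)

definition dual_tuples :: "nat \<Rightarrow> nat \<Rightarrow> (dual, nat \<Rightarrow> dual) module" where
  "dual_tuples n m =
     \<lparr>carrier = (\<Pi>\<^sub>E i\<in>{1..n+m}. if i \<le> n then carrier dual_ring
                               else {dual_of_real a \<otimes>\<^bsub>dual_ring\<^esub> dual_unit | a. True}),
      monoid.mult = undefined,
      one = undefined,
      zero = (\<lambda>i\<in>{1..n+m}. \<zero>\<^bsub>dual_ring\<^esub>),
      add = (\<lambda>x y. \<lambda>i\<in>{1..n+m}. x i \<oplus>\<^bsub>dual_ring\<^esub> y i),
      smult = (\<lambda>c x. \<lambda>i\<in>{1..n+m}. c \<otimes>\<^bsub>dual_ring\<^esub> x i)\<rparr>"

definition module_isos ::
  "('a, 'r) ring_scheme \<Rightarrow> ('a, 'v, 'x) module_scheme \<Rightarrow> ('a, 'w, 'y) module_scheme \<Rightarrow> ('v \<Rightarrow> 'w) set"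
  where
  "module_isos R V W =
     {h \<in> iso (add_monoid V) (add_monoid W).
        \<forall>c\<in>carrier R. \<forall>v\<in>carrier V. h (c \<odot>\<^bsub>V\<^esub> v) = c \<odot>\<^bsub>W\<^esub> h v}"

definition modules_isomorphic ::
  "('a, 'r) ring_scheme \<Rightarrow> ('a, 'v, 'x) module_scheme \<Rightarrow> ('a, 'w, 'y) module_scheme \<Rightarrow> bool" where
  "modules_isomorphic R V W \<longleftrightarrow> module_isos R V W \<noteq> {}"

lemma dual_of_real_mult_unit:
  "dual_of_real a \<otimes>\<^bsub>dual_ring\<^esub> dual_unit = (0, a)"
  by (simp add: dual_ring_def dual_of_real_def dual_unit_def)

lemma cring_dual_ring: "cring dual_ring"
proof (rule cringI)
  show "abelian_group dual_ring"
  proof (rule abelian_groupI)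
    fix x assume "x \<in> carrier dual_ring"
    show "\<exists>y\<in>carrier dual_ring. y \<oplus>\<^bsub>dual_ring\<^esub> x = \<zero>\<^bsub>dual_ring\<^esub>"
      by (rule bexI[of _ "(- fst x, - snd x)"]) (simp_all add: dual_ring_def)
  qed (simp_all add: dual_ring_def)
  show "Group.comm_monoid dual_ring"
    by (rule comm_monoidI) (simp_all add: dual_ring_def algebra_simps)
qed (simp add: dual_ring_def algebra_simps)

lemma module_dual_tuples: "Module.module dual_ring (dual_tuples n m)"
proof (rule moduleI)
  show "cring dual_ring" by (rule cring_dual_ring)
  show "abelian_group (dual_tuples n m)"
  proof (rule abelian_groupI)
    fix x assume x: "x \<in> carrier (dual_tuples n m)"
    show "\<zero>\<^bsub>dual_tuples n m\<^esub> \<oplus>\<^bsub>dual_tuples n m\<^esub> x = x"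
      using x by (auto simp: dual_tuples_def dual_ring_def PiE_iff extensional_def fun_eq_iff)
    show "\<exists>y\<in>carrier (dual_tuples n m). y \<oplus>\<^bsub>dual_tuples n m\<^esub> x = \<zero>\<^bsub>dual_tuples n m\<^esub>"
    proof (rule bexI)
      let ?y = "\<lambda>i\<in>{1..n+m}. (- fst (x i), - snd (x i))"
      show "?y \<oplus>\<^bsub>dual_tuples n m\<^esub> x = \<zero>\<^bsub>dual_tuples n m\<^esub>"
        by (auto simp: dual_tuples_def dual_ring_def fun_eq_iff)
      show "?y \<in> carrier (dual_tuples n m)"
        using x by (force simp: dual_tuples_def dual_of_real_mult_unit PiE_iff dual_ring_def
            dual_of_real_def dual_unit_def)
    qed
  qed (force simp: dual_tuples_def dual_ring_def dual_of_real_def dual_unit_def PiE_iff fun_eq_iff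
        extensional_def)+
qed (force simp: dual_tuples_def dual_ring_def dual_of_real_def dual_unit_def PiE_iff fun_eq_iff
       extensional_def algebra_simps)+

end

theory Submission
  imports Defs "HOL-Algebra.Coset"
begin

text \<open>
  Coordinates with respect to a basis identify \<open>V\<close> with the tuple module: if \<open>(S1 \<parallel> S2)\<close> is a
  basis with \<open>n\<close> and \<open>m\<close> elements, then a tuple is sent to the combination of the basis that has
  its entries as coefficients.  This map is onto because the basis spans, and one-to-one because the
  basis is independent; it is linear over the dual numbers because on the kernel of \<open>1#\<close> a scalar
  \<open>a + b 1#\<close> acts as the real number \<open>a\<close> (\<open>smult_ker_dual\<close>, \<open>dual_basis_imp_isomorphic\<close>).
  Conversely, the tuple module has an evident basis of the right size, and isomorphisms transport
  bases (\<open>dual_basis_dual_tuples\<close>, \<open>module_isos_dual_basis\<close>).  Hence \<open>V\<close> has a basis of size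
  \<open>(n, m)\<close> exactly if it is isomorphic to the tuple module of that size.

  What remains is that the size of a basis is unique, for only then is the definite description
  \<open>dual_dim\<close> determined.  By the equivalence above this says that tuple modules of different sizes
  are not isomorphic.  Two real vector spaces attached to a module distinguish them: the kernel of
  \<open>1#\<close> has real dimension \<open>n + m\<close> and the image of \<open>1#\<close> has real dimension \<open>n\<close>, and an
  isomorphism maps the kernel into the kernel and the image into the image
  (\<open>dual_tuples_isos_rank_le\<close>).  That an injective real-linear map does not lower the dimension is
  used in the form that a homogeneous linear system with fewer equations than unknowns has a
  nontrivial solution (\<open>underdetermined_system\<close>).
\<close>

section \<open>Homogeneous linear systems\<close>

text \<open>
  The equations are arbitrary linear functionals \<open>\<Phi> i\<close>, so that no matrix has to be extracted from
  them.  In the induction step, two linearly independent solutions of all equations but one are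
  available, since an unknown can be dropped in two different ways; some combination of them solves
  the last equation as well.
\<close>

lemma underdetermined_system:
  fixes \<Phi> :: "'i \<Rightarrow> ('j \<Rightarrow> 'k::field) \<Rightarrow> 'k"
  assumes "finite I" and "card I < card J"
    and "\<And>i c d. i \<in> I \<Longrightarrow> \<Phi> i (\<lambda>j. c j + d j) = \<Phi> i c + \<Phi> i d"
    and "\<And>i r c. i \<in> I \<Longrightarrow> \<Phi> i (\<lambda>j. r * c j) = r * \<Phi> i c"
  shows "\<exists>c. (\<exists>j\<in>J. c j \<noteq> 0) \<and> (\<forall>j. j \<notin> J \<longrightarrow> c j = 0) \<and> (\<forall>i\<in>I. \<Phi> i c = 0)"
  using assms
proof (induction I arbitrary: J rule: finite_induct)
  case empty
  then obtain j where "j \<in> J"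
    by (metis card.empty card_gt_0_iff ex_in_conv)
  then show ?case
    by (intro exI[of _ "\<lambda>k. if k = j then 1 else 0"]) auto
next
  case (insert i I)
  have fin: "finite J"
    using insert.prems(1) by (metis card.infinite not_less_zero)
  have smaller: "\<exists>c. (\<exists>j\<in>J - {k}. c j \<noteq> 0) \<and> (\<forall>j. j \<notin> J - {k} \<longrightarrow> c j = 0) \<and> (\<forall>i\<in>I. \<Phi> i c = 0)"
    if "k \<in> J" for k
    using insert that fin by (intro insert.IH) auto
  from insert.prems(1) obtain k where "k \<in> J"
    by (metis card.empty ex_in_conv not_less_zero)
  from smaller[OF this] obtain c l where c: "l \<in> J" "c l \<noteq> 0"
      "\<And>j. j \<notin> J \<Longrightarrow> c j = 0" "\<And>i. i \<in> I \<Longrightarrow> \<Phi> i c = 0"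
    by blast
  \<comment> \<open>Dropping the unknown \<open>l\<close>, at which \<open>c\<close> does not vanish, makes \<open>d\<close> independent of \<open>c\<close>.\<close>
  from smaller[OF \<open>l \<in> J\<close>] obtain d where d: "\<exists>j\<in>J. d j \<noteq> 0" "d l = 0"
      "\<And>j. j \<notin> J \<Longrightarrow> d j = 0" "\<And>i. i \<in> I \<Longrightarrow> \<Phi> i d = 0"
    by blast
  show ?case
  proof (cases "\<Phi> i d = 0")
    case True
    with d show ?thesis by blast
  next
    case False
    let ?e = "\<lambda>j. \<Phi> i d * c j + - \<Phi> i c * d j"
    have "\<Phi> i' ?e = \<Phi> i d * \<Phi> i' c + - \<Phi> i c * \<Phi> i' d" if "i' \<in> insert i I" for i'
      using insert.prems(2)[OF that, of "\<lambda>j. \<Phi> i d * c j" "\<lambda>j. - \<Phi> i c * d j"]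
      by (simp only: insert.prems(3)[OF that])
    then have "\<forall>i'\<in>insert i I. \<Phi> i' ?e = 0"
      using c(4) d(4) by auto
    moreover have "?e l \<noteq> 0" using False c d by simp
    ultimately show ?thesis
      using c(1,3) d(3) by (intro exI[of _ ?e]) auto
  qed
qed

section \<open>Isomorphisms of modules\<close>

lemma module_isosD:
  assumes "h \<in> module_isos R V W"
  shows "bij_betw h (carrier V) (carrier W)"
    and "\<And>v. v \<in> carrier V \<Longrightarrow> h v \<in> carrier W"
    and "\<And>v w. v \<in> carrier V \<Longrightarrow> w \<in> carrier V \<Longrightarrow> h (v \<oplus>\<^bsub>V\<^esub> w) = h v \<oplus>\<^bsub>W\<^esub> h w"
    and "\<And>c v. c \<in> carrier R \<Longrightarrow> v \<in> carrier V \<Longrightarrow> h (c \<odot>\<^bsub>V\<^esub> v) = c \<odot>\<^bsub>W\<^esub> h v"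
  using assms by (auto simp: module_isos_def iso_def hom_def)

lemma module_isos_inv:
  assumes "Module.module R V" and h: "h \<in> module_isos R V W"
  shows "inv_into (carrier V) h \<in> module_isos R W V"
proof -
  interpret module R V by fact
  note bij = module_isosD(1)[OF h]
  have iso: "inv_into (carrier V) h \<in> iso (add_monoid W) (add_monoid V)"
    using M.add.iso_set_sym[of h "add_monoid W"] h by (simp add: module_isos_def)
  have "inv_into (carrier V) h (c \<odot>\<^bsub>W\<^esub> w) = c \<odot>\<^bsub>V\<^esub> inv_into (carrier V) h w"
    if c: "c \<in> carrier R" and w: "w \<in> carrier W" for c w
  proof -
    obtain v where v: "v \<in> carrier V" "w = h v"
      using bij w by (auto simp: bij_betw_def)
    then show ?thesis
      using c bij module_isosD(4)[OF h c v(1), symmetric]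
      by (simp add: bij_betw_def inv_into_f_f)
  qed
  with iso show ?thesis by (simp add: module_isos_def)
qed

lemma module_isos_comp:
  assumes "h \<in> module_isos R U V" and "k \<in> module_isos R V W"
  shows "k \<circ> h \<in> module_isos R U W"
proof -
  have "k \<circ> h \<in> iso (add_monoid U) (add_monoid W)"
    using assms by (intro iso_set_trans[of h _ "add_monoid V"]) (simp_all add: module_isos_def)
  then show ?thesis
    using module_isosD(2,4)[OF assms(1)] module_isosD(4)[OF assms(2)]
    by (simp add: module_isos_def)
qed

lemma module_isos_zero:
  assumes "Module.module R V" and "Module.module R W" and h: "h \<in> module_isos R V W"
  shows "h \<zero>\<^bsub>V\<^esub> = \<zero>\<^bsub>W\<^esub>"
proof -
  interpret V: module R V by fact
  interpret W: module R W by fact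
  have "h (\<zero>\<^bsub>R\<^esub> \<odot>\<^bsub>V\<^esub> \<zero>\<^bsub>V\<^esub>) = \<zero>\<^bsub>R\<^esub> \<odot>\<^bsub>W\<^esub> h \<zero>\<^bsub>V\<^esub>"
    using h by (simp add: module_isosD(4) del: V.smult_l_null V.smult_r_null W.smult_l_null W.smult_r_null)
  then show ?thesis using module_isosD(2)[OF h] by simp
qed

lemma module_isos_finsum:
  assumes "Module.module R V" and "Module.module R W" and h: "h \<in> module_isos R V W"
    and "finite A" and "f \<in> A \<rightarrow> carrier V"
  shows "h (\<Oplus>\<^bsub>V\<^esub>a\<in>A. f a) = (\<Oplus>\<^bsub>W\<^esub>a\<in>A. h (f a))"
proof -
  interpret V: module R V by fact
  interpret W: module R W by fact
  from assms(4,5) show ?thesis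
    by (induction A rule: finite_induct)
      (simp_all add: Pi_iff module_isos_zero[OF assms(1-3)] module_isosD[OF h]
        V.M.finsum_insert W.M.finsum_insert V.M.finsum_closed)
qed

section \<open>The tuple modules and their rank\<close>

lemma carrier_dual_ring [simp]: "carrier dual_ring = UNIV"
  and zero_dual_ring [simp]: "\<zero>\<^bsub>dual_ring\<^esub> = (0, 0)"
  and one_dual_ring [simp]: "\<one>\<^bsub>dual_ring\<^esub> = (1, 0)"
  and add_dual_ring [simp]: "x \<oplus>\<^bsub>dual_ring\<^esub> y = (fst x + fst y, snd x + snd y)"
  and mult_dual_ring [simp]: "x \<otimes>\<^bsub>dual_ring\<^esub> y = (fst x * fst y, fst x * snd y + snd x * fst y)"
  by (simp_all add: dual_ring_def)

lemma carrier_dual_tuples [simp]: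
  "x \<in> carrier (dual_tuples n m) \<longleftrightarrow>
     x \<in> extensional {1..n+m} \<and> (\<forall>i\<in>{1..n+m}. n < i \<longrightarrow> fst (x i) = 0)"
proof -
  have "{dual_of_real a \<otimes>\<^bsub>dual_ring\<^esub> dual_unit | a. True} = {p. fst p = 0}"
    by (auto simp: dual_of_real_mult_unit prod_eq_iff simp del: mult_dual_ring)
  then show ?thesis
    by (auto simp: dual_tuples_def PiE_iff)
qed

lemma zero_dual_tuples [simp]: "\<zero>\<^bsub>dual_tuples n m\<^esub> = (\<lambda>i\<in>{1..n+m}. (0, 0))"
  and add_dual_tuples [simp]:
    "x \<oplus>\<^bsub>dual_tuples n m\<^esub> y = (\<lambda>i\<in>{1..n+m}. (fst (x i) + fst (y i), snd (x i) + snd (y i)))"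
  and smult_dual_tuples [simp]:
    "c \<odot>\<^bsub>dual_tuples n m\<^esub> x =
      (\<lambda>i\<in>{1..n+m}. (fst c * fst (x i), fst c * snd (x i) + snd c * fst (x i)))"
  by (simp_all add: dual_tuples_def)

text \<open>
  The first inequality compares the images of \<open>1#\<close>, the second one its kernels.  The tuples
  \<open>E c\<close> with entries \<open>c i 1#\<close> make up the kernel, and those with \<open>c\<close> vanishing outside of
  \<open>{1..n}\<close> make up the image.  If \<open>h\<close> sent a space of such tuples into a smaller one of the same
  kind, then the linear system \<open>h (E c) = 0\<close> would have a nontrivial solution \<open>c\<close>, although \<open>h\<close> is
  injective.
\<close>

lemma dual_tuples_isos_rank_le:
  assumes h: "h \<in> module_isos dual_ring (dual_tuples n m) (dual_tuples n' m')"
  shows "n \<le> n'" and "n + m \<le> n' + m'"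
proof -
  define E where "E c = (\<lambda>i\<in>{1..n+m}. (0::real, c i :: real))" for c
  have E: "E c \<in> carrier (dual_tuples n m)" for c
    by (simp add: E_def)
  have hE: "h (E c) \<in> carrier (dual_tuples n' m')" for c
    using h E by (rule module_isosD(2))
  have E_add: "h (E (\<lambda>j. c j + d j)) i = (fst (h (E c) i) + fst (h (E d) i), snd (h (E c) i) + snd (h (E d) i))"
    if "i \<in> {1..n'+m'}" for c d i
  proof -
    have "E (\<lambda>j. c j + d j) = E c \<oplus>\<^bsub>dual_tuples n m\<^esub> E d"
      by (auto simp: E_def fun_eq_iff)
    then show ?thesis
      using module_isosD(3)[OF h E[of c] E[of d]] that by simp
  qed
  have E_scale: "h (E (\<lambda>j. r * c j)) i = (r * fst (h (E c) i), r * snd (h (E c) i))"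
    if "i \<in> {1..n'+m'}" for c r i
  proof -
    have "E (\<lambda>j. r * c j) = (r, 0) \<odot>\<^bsub>dual_tuples n m\<^esub> E c"
      by (auto simp: E_def fun_eq_iff)
    then show ?thesis
      using module_isosD(4)[OF h _ E[of c], of "(r, 0)"] that by simp
  qed
  \<comment> \<open>Being killed by \<open>1#\<close> is stated as \<open>1# x = 0 x\<close>, an equation between multiples of \<open>x\<close>, which
      \<open>h\<close> preserves.\<close>
  have fst_zero: "fst (h (E c) i) = 0" if "i \<in> {1..n'+m'}" for c i
  proof -
    have "(0, 1) \<odot>\<^bsub>dual_tuples n m\<^esub> E c = (0, 0) \<odot>\<^bsub>dual_tuples n m\<^esub> E c"
      by (auto simp: E_def fun_eq_iff)
    then have "(0, 1) \<odot>\<^bsub>dual_tuples n' m'\<^esub> h (E c) = (0, 0) \<odot>\<^bsub>dual_tuples n' m'\<^esub> h (E c)"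
      using module_isosD(4)[OF h _ E[of c]] by (metis UNIV_I carrier_dual_ring)
    from fun_cong[OF this, of i] that show ?thesis by simp
  qed
  \<comment> \<open>The unknowns are the \<open>c j\<close> with \<open>j \<in> J\<close>; only the coordinates in \<open>I\<close> impose a condition.\<close>
  have card_le: "card J \<le> card I"
    if J: "J \<subseteq> {1..n+m}" and I: "I \<subseteq> {1..n'+m'}"
      and out: "\<And>c i. \<forall>j. j \<notin> J \<longrightarrow> c j = 0 \<Longrightarrow> i \<in> {1..n'+m'} - I \<Longrightarrow> snd (h (E c) i) = 0"
    for I J
  proof (rule ccontr)
    assume "\<not> card J \<le> card I"
    then have "\<exists>c. (\<exists>j\<in>J. c j \<noteq> 0) \<and> (\<forall>j. j \<notin> J \<longrightarrow> c j = 0) \<and> (\<forall>i\<in>I. snd (h (E c) i) = 0)"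
      using I finite_subset[OF I] E_add E_scale
      by (intro underdetermined_system) (auto simp: subset_iff)
    then obtain c j where c: "j \<in> J" "c j \<noteq> 0" "\<forall>j. j \<notin> J \<longrightarrow> c j = 0"
        "\<And>i. i \<in> I \<Longrightarrow> snd (h (E c) i) = 0"
      by blast
    then have snd_zero: "snd (h (E c) i) = 0" if "i \<in> {1..n'+m'}" for i
      using out that by blast
    have "h (E c) i = h (E (\<lambda>j. 0 * c j)) i" for i
    proof (cases "i \<in> {1..n'+m'}")
      case True
      then show ?thesis
        using E_scale[of i 0 c] fst_zero[of i c] snd_zero[of i]
        by (simp add: prod_eq_iff)
    next
      case False
      then show ?thesis
        using hE[of c] hE[of "\<lambda>j. 0 * c j"] by (simp add: extensional_def)
    qed
    then have "E c = E (\<lambda>j. 0 * c j)"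
      using module_isosD(1)[OF h] E by (metis bij_betw_def ext inj_onD)
    from fun_cong[OF this, of j] c J show False
      by (auto simp: E_def subset_iff)
  qed
  show "n + m \<le> n' + m'"
    using card_le[of "{1..n+m}" "{1..n'+m'}"] by simp
  have "snd (h (E c) i) = 0" if c: "\<forall>j. j \<notin> {1..n} \<longrightarrow> c j = 0" and i: "i \<in> {1..n'+m'} - {1..n'}" for c i
  proof -
    define x where "x = (\<lambda>i\<in>{1..n+m}. (c i, 0::real))"
    have x: "x \<in> carrier (dual_tuples n m)"
      using c by (auto simp: x_def)
    have "E c = (0, 1) \<odot>\<^bsub>dual_tuples n m\<^esub> x"
      by (auto simp: E_def x_def fun_eq_iff)
    then have "h (E c) = (0, 1) \<odot>\<^bsub>dual_tuples n' m'\<^esub> h x"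
      using module_isosD(4)[OF h _ x, of "(0, 1)"] by simp
    then show ?thesis
      using i module_isosD(2)[OF h x] by auto
  qed
  then show "n \<le> n'"
    using card_le[of "{1..n}" "{1..n'}"] by simp
qed

section \<open>Dual linear combinations\<close>

text \<open>Since \<open>1#\<close> kills \<open>w\<close>, the second summand of a scalar \<open>a + b 1#\<close> contributes nothing.\<close>

lemma smult_ker_dual:
  assumes "Module.module dual_ring V" and w: "w \<in> ker_dual V"
  shows "c \<odot>\<^bsub>V\<^esub> w = dual_of_real (fst c) \<odot>\<^bsub>V\<^esub> w"
proof -
  interpret module dual_ring V by fact
  have w: "w \<in> carrier V" "dual_unit \<odot>\<^bsub>V\<^esub> w = \<zero>\<^bsub>V\<^esub>"
    using w by (auto simp: ker_dual_def)
  have "c \<odot>\<^bsub>V\<^esub> w =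
      (dual_of_real (fst c) \<oplus>\<^bsub>dual_ring\<^esub> dual_of_real (snd c) \<otimes>\<^bsub>dual_ring\<^esub> dual_unit) \<odot>\<^bsub>V\<^esub> w"
    by (simp add: dual_of_real_def dual_unit_def)
  also have "\<dots> = dual_of_real (fst c) \<odot>\<^bsub>V\<^esub> w \<oplus>\<^bsub>V\<^esub> dual_of_real (snd c) \<odot>\<^bsub>V\<^esub> (dual_unit \<odot>\<^bsub>V\<^esub> w)"
    using w smult_l_distr smult_assoc1 by (simp del: add_dual_ring mult_dual_ring)
  finally show ?thesis using w by simp
qed

lemma dual_combination_closed:
  assumes "Module.module dual_ring V" and "A \<subseteq> carrier V" and "B \<subseteq> carrier V"
  shows "dual_combination V A c B d \<in> carrier V"
proof -
  interpret module dual_ring V by fact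
  show ?thesis
    unfolding dual_combination_def using assms(2,3)
    by (intro M.a_closed M.finsum_closed) auto
qed

lemma dual_combination_cong:
  assumes "Module.module dual_ring V" and "A \<subseteq> carrier V" and "B \<subseteq> carrier V"
    and "\<And>v. v \<in> A \<Longrightarrow> c v = c' v" and "\<And>w. w \<in> B \<Longrightarrow> d w = d' w"
  shows "dual_combination V A c B d = dual_combination V A c' B d'"
proof -
  interpret module dual_ring V by fact
  show ?thesis
    unfolding dual_combination_def using assms(2-5)
    by (intro arg_cong2[where f = "add V"] M.finsum_cong') auto
qed

lemma dual_combination_add:
  assumes "Module.module dual_ring V" and A: "A \<subseteq> carrier V" and B: "B \<subseteq> carrier V"
  shows "dual_combination V A (\<lambda>v. c v \<oplus>\<^bsub>dual_ring\<^esub> c' v) B (\<lambda>w. d w + d' w) =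
    dual_combination V A c B d \<oplus>\<^bsub>V\<^esub> dual_combination V A c' B d'"
proof -
  interpret module dual_ring V by fact
  have sum: "(\<Oplus>\<^bsub>V\<^esub>v\<in>C. (a v \<oplus>\<^bsub>dual_ring\<^esub> a' v) \<odot>\<^bsub>V\<^esub> v) = (\<Oplus>\<^bsub>V\<^esub>v\<in>C. a v \<odot>\<^bsub>V\<^esub> v) \<oplus>\<^bsub>V\<^esub> (\<Oplus>\<^bsub>V\<^esub>v\<in>C. a' v \<odot>\<^bsub>V\<^esub> v)"
    and closed: "(\<Oplus>\<^bsub>V\<^esub>v\<in>C. a v \<odot>\<^bsub>V\<^esub> v) \<in> carrier V"
    if C: "C \<subseteq> carrier V" for C a a'
  proof -
    have "(\<Oplus>\<^bsub>V\<^esub>v\<in>C. (a v \<oplus>\<^bsub>dual_ring\<^esub> a' v) \<odot>\<^bsub>V\<^esub> v) = (\<Oplus>\<^bsub>V\<^esub>v\<in>C. a v \<odot>\<^bsub>V\<^esub> v \<oplus>\<^bsub>V\<^esub> a' v \<odot>\<^bsub>V\<^esub> v)"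
      using C by (intro M.finsum_cong') (auto simp: smult_l_distr simp del: add_dual_ring)
    also have "\<dots> = (\<Oplus>\<^bsub>V\<^esub>v\<in>C. a v \<odot>\<^bsub>V\<^esub> v) \<oplus>\<^bsub>V\<^esub> (\<Oplus>\<^bsub>V\<^esub>v\<in>C. a' v \<odot>\<^bsub>V\<^esub> v)"
      using C by (intro M.finsum_addf) auto
    finally show "(\<Oplus>\<^bsub>V\<^esub>v\<in>C. (a v \<oplus>\<^bsub>dual_ring\<^esub> a' v) \<odot>\<^bsub>V\<^esub> v) = (\<Oplus>\<^bsub>V\<^esub>v\<in>C. a v \<odot>\<^bsub>V\<^esub> v) \<oplus>\<^bsub>V\<^esub> (\<Oplus>\<^bsub>V\<^esub>v\<in>C. a' v \<odot>\<^bsub>V\<^esub> v)" .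
    show "(\<Oplus>\<^bsub>V\<^esub>v\<in>C. a v \<odot>\<^bsub>V\<^esub> v) \<in> carrier V"
      using C by (intro M.finsum_closed) auto
  qed
  have "dual_of_real (x + y) = dual_of_real x \<oplus>\<^bsub>dual_ring\<^esub> dual_of_real y" for x y
    by (simp add: dual_of_real_def)
  then show ?thesis
    unfolding dual_combination_def
    by (simp add: sum[OF A] sum[OF B] closed[OF A] closed[OF B] M.a_ac del: add_dual_ring)
qed

text \<open>
  The real coefficients are multiplied by \<open>fst r\<close> only, which is right because \<open>B\<close> lies in the
  kernel of \<open>1#\<close>.
\<close>

lemma dual_combination_smult:
  assumes V: "Module.module dual_ring V" and A: "A \<subseteq> carrier V" "finite A" and B: "B \<subseteq> ker_dual V" "finite B"
  shows "dual_combination V A (\<lambda>v. r \<otimes>\<^bsub>dual_ring\<^esub> c v) B (\<lambda>w. fst r * d w) =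
    r \<odot>\<^bsub>V\<^esub> dual_combination V A c B d"
proof -
  interpret module dual_ring V by fact
  have B': "B \<subseteq> carrier V" using B by (auto simp: ker_dual_def)
  have sum: "(\<Oplus>\<^bsub>V\<^esub>v\<in>C. (r \<otimes>\<^bsub>dual_ring\<^esub> a v) \<odot>\<^bsub>V\<^esub> v) = r \<odot>\<^bsub>V\<^esub> (\<Oplus>\<^bsub>V\<^esub>v\<in>C. a v \<odot>\<^bsub>V\<^esub> v)"
    and closed: "(\<Oplus>\<^bsub>V\<^esub>v\<in>C. a v \<odot>\<^bsub>V\<^esub> v) \<in> carrier V"
    if C: "C \<subseteq> carrier V" "finite C" for C a
  proof -
    have "(\<Oplus>\<^bsub>V\<^esub>v\<in>C. (r \<otimes>\<^bsub>dual_ring\<^esub> a v) \<odot>\<^bsub>V\<^esub> v) = (\<Oplus>\<^bsub>V\<^esub>v\<in>C. r \<odot>\<^bsub>V\<^esub> (a v \<odot>\<^bsub>V\<^esub> v))"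
      using C by (intro M.finsum_cong') (auto simp: smult_assoc1 simp del: mult_dual_ring)
    also have "\<dots> = r \<odot>\<^bsub>V\<^esub> (\<Oplus>\<^bsub>V\<^esub>v\<in>C. a v \<odot>\<^bsub>V\<^esub> v)"
      using C by (intro finsum_smult_ldistr[symmetric]) auto
    finally show "(\<Oplus>\<^bsub>V\<^esub>v\<in>C. (r \<otimes>\<^bsub>dual_ring\<^esub> a v) \<odot>\<^bsub>V\<^esub> v) = r \<odot>\<^bsub>V\<^esub> (\<Oplus>\<^bsub>V\<^esub>v\<in>C. a v \<odot>\<^bsub>V\<^esub> v)" .
    show "(\<Oplus>\<^bsub>V\<^esub>v\<in>C. a v \<odot>\<^bsub>V\<^esub> v) \<in> carrier V"
      using C by (intro M.finsum_closed) auto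
  qed
  have "dual_of_real (fst r * d w) \<odot>\<^bsub>V\<^esub> w = (r \<otimes>\<^bsub>dual_ring\<^esub> dual_of_real (d w)) \<odot>\<^bsub>V\<^esub> w" if "w \<in> B" for w
    using smult_ker_dual[OF V, of w "r \<otimes>\<^bsub>dual_ring\<^esub> dual_of_real (d w)"] B that
    by (auto simp: dual_of_real_def)
  then have "(\<Oplus>\<^bsub>V\<^esub>w\<in>B. dual_of_real (fst r * d w) \<odot>\<^bsub>V\<^esub> w) =
      (\<Oplus>\<^bsub>V\<^esub>w\<in>B. (r \<otimes>\<^bsub>dual_ring\<^esub> dual_of_real (d w)) \<odot>\<^bsub>V\<^esub> w)"
    using B' by (intro M.finsum_cong') auto
  then show ?thesis
    unfolding dual_combination_def
    using sum closed A B' B(2) by (simp add: smult_r_distr del: mult_dual_ring)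
qed

text \<open>
  A spanning family provides combinations of varying finite subsets; padding the coefficients with
  zeros turns them into combinations of one fixed family, to which a tuple of coordinates belongs.
\<close>

lemma dual_combination_extend:
  assumes "Module.module dual_ring V" and S: "S \<subseteq> carrier V" "finite S" and T: "T \<subseteq> carrier V" "finite T"
    and "A \<subseteq> S" and "B \<subseteq> T"
  shows "dual_combination V A c B d =
    dual_combination V S (\<lambda>v. if v \<in> A then c v else (0, 0)) T (\<lambda>w. if w \<in> B then d w else 0)"
proof -
  interpret module dual_ring V by fact
  have sum: "(\<Oplus>\<^bsub>V\<^esub>v\<in>C. a v \<odot>\<^bsub>V\<^esub> v) = (\<Oplus>\<^bsub>V\<^esub>v\<in>D. (if v \<in> C then a v else (0, 0)) \<odot>\<^bsub>V\<^esub> v)"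
    if "D \<subseteq> carrier V" "finite D" "C \<subseteq> D" for C D a
    using that smult_l_null
    by (intro M.add.finprod_mono_neutral_cong_left) (auto simp: subset_iff)
  have "dual_of_real (if P then x else 0) = (if P then dual_of_real x else (0, 0))" for P x
    by (simp add: dual_of_real_def)
  then show ?thesis
    unfolding dual_combination_def using sum[OF S assms(6)] sum[OF T assms(7)] by simp
qed

section \<open>Isomorphisms transport bases\<close>

lemma module_isos_dual_basis:
  assumes V: "Module.module dual_ring V" and W: "Module.module dual_ring W"
    and h: "h \<in> module_isos dual_ring V W" and basis: "dual_basis V S1 S2"
  shows "dual_basis W (h ` S1) (h ` S2)"
proof -
  interpret V: module dual_ring V by fact
  interpret W: module dual_ring W by fact
  note hD = module_isosD[OF h]
  have S1: "S1 \<subseteq> carrier V" and S2: "S2 \<subseteq> carrier V" and ker: "S2 \<subseteq> ker_dual V"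
    using basis by (auto simp: dual_basis_def ker_dual_def)
  have inj: "inj_on h (carrier V)"
    using hD(1) by (simp add: bij_betw_def)
  have sum: "(\<Oplus>\<^bsub>W\<^esub>w\<in>h ` A. c w \<odot>\<^bsub>W\<^esub> w) = h (\<Oplus>\<^bsub>V\<^esub>v\<in>A. c (h v) \<odot>\<^bsub>V\<^esub> v)"
    and closed: "(\<Oplus>\<^bsub>V\<^esub>v\<in>A. c (h v) \<odot>\<^bsub>V\<^esub> v) \<in> carrier V"
    if A: "finite A" "A \<subseteq> carrier V" for A c
  proof -
    have "(\<Oplus>\<^bsub>W\<^esub>w\<in>h ` A. c w \<odot>\<^bsub>W\<^esub> w) = (\<Oplus>\<^bsub>W\<^esub>v\<in>A. c (h v) \<odot>\<^bsub>W\<^esub> h v)"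
      using A hD(2) inj_on_subset[OF inj A(2)] by (subst W.M.finsum_reindex) auto
    also have "\<dots> = (\<Oplus>\<^bsub>W\<^esub>v\<in>A. h (c (h v) \<odot>\<^bsub>V\<^esub> v))"
      using A hD(2,4) by (intro W.M.finsum_cong') (auto simp: subset_iff)
    also have "\<dots> = h (\<Oplus>\<^bsub>V\<^esub>v\<in>A. c (h v) \<odot>\<^bsub>V\<^esub> v)"
      using A by (intro module_isos_finsum[OF V W h, symmetric]) auto
    finally show "(\<Oplus>\<^bsub>W\<^esub>w\<in>h ` A. c w \<odot>\<^bsub>W\<^esub> w) = h (\<Oplus>\<^bsub>V\<^esub>v\<in>A. c (h v) \<odot>\<^bsub>V\<^esub> v)" .
    show "(\<Oplus>\<^bsub>V\<^esub>v\<in>A. c (h v) \<odot>\<^bsub>V\<^esub> v) \<in> carrier V"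
      using A by (intro V.M.finsum_closed) auto
  qed
  have comb: "dual_combination W (h ` A) c (h ` B) d = h (dual_combination V A (c \<circ> h) B (d \<circ> h))"
      and comb_closed: "dual_combination V A (c \<circ> h) B (d \<circ> h) \<in> carrier V"
    if AB: "finite A" "A \<subseteq> S1" "finite B" "B \<subseteq> S2" for A B c d
    using AB S1 S2 sum[of A c] closed[of A c] sum[of B "\<lambda>w. dual_of_real (d w)"]
      closed[of B "\<lambda>w. dual_of_real (d w)"] hD(3)
    by (auto simp: dual_combination_def)
  have "dual_independent W (h ` S1) (h ` S2)"
    unfolding dual_independent_def
  proof (intro allI impI)
    fix A' B' c d
    assume A': "finite A'" "A' \<subseteq> h ` S1" and B': "finite B'" "B' \<subseteq> h ` S2"
      and zero: "dual_combination W A' c B' d = \<zero>\<^bsub>W\<^esub>"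
    obtain A B where A: "finite A" "A \<subseteq> S1" "A' = h ` A" and B: "finite B" "B \<subseteq> S2" "B' = h ` B"
      by (metis A' B' finite_subset_image)
    have "h (dual_combination V A (c \<circ> h) B (d \<circ> h)) = h \<zero>\<^bsub>V\<^esub>"
      using zero A B comb module_isos_zero[OF V W h] by simp
    then have "dual_combination V A (c \<circ> h) B (d \<circ> h) = \<zero>\<^bsub>V\<^esub>"
      using comb_closed A B inj by (metis V.M.zero_closed inj_onD)
    then have "(\<forall>v\<in>A. (c \<circ> h) v = \<zero>\<^bsub>dual_ring\<^esub>) \<and> (\<forall>w\<in>B. (d \<circ> h) w = 0)"
      using basis A B unfolding dual_basis_def dual_independent_def by blast
    then show "(\<forall>v\<in>A'. c v = \<zero>\<^bsub>dual_ring\<^esub>) \<and> (\<forall>w\<in>B'. d w = 0)"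
      using A B by auto
  qed
  moreover have "dual_spanning W (h ` S1) (h ` S2)"
    unfolding dual_spanning_def
  proof
    fix w assume "w \<in> carrier W"
    then obtain v where v: "v \<in> carrier V" "w = h v"
      using hD(1) by (auto simp: bij_betw_def)
    then obtain A B c d where AB: "finite A" "A \<subseteq> S1" "finite B" "B \<subseteq> S2"
        and vc: "v = dual_combination V A c B d"
      using basis unfolding dual_basis_def dual_spanning_def by blast
    \<comment> \<open>Coefficients are functions of the vectors, so they are carried over to \<open>W\<close> along \<open>h\<close> backwards.\<close>
    define k where "k = inv_into (carrier V) h"
    have k: "k (h u) = u" if "u \<in> carrier V" for u
      using inj that by (simp add: k_def)
    have "v = dual_combination V A (c \<circ> k \<circ> h) B (d \<circ> k \<circ> h)"
      unfolding vc dual_combination_def using AB S1 S2 k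
      by (intro arg_cong2[where f = "add V"] V.M.finsum_cong') (auto simp: subset_iff)
    then have "w = dual_combination W (h ` A) (c \<circ> k) (h ` B) (d \<circ> k)"
      using comb[OF AB, of "c \<circ> k" "d \<circ> k"] v by (simp add: o_assoc)
    then show "\<exists>A B c d. finite A \<and> A \<subseteq> h ` S1 \<and> finite B \<and> B \<subseteq> h ` S2 \<and>
        w = dual_combination W A c B d"
      using AB by (intro exI[of _ "h ` A"] exI[of _ "h ` B"] exI[of _ "c \<circ> k"] exI[of _ "d \<circ> k"]) auto
  qed
  moreover have "h ` S2 \<subseteq> ker_dual W"
  proof
    fix w assume "w \<in> h ` S2"
    then obtain v where v: "v \<in> carrier V" "dual_unit \<odot>\<^bsub>V\<^esub> v = \<zero>\<^bsub>V\<^esub>" "w = h v"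
      using ker by (auto simp: ker_dual_def)
    then show "w \<in> ker_dual W"
      using hD(2)[of v] hD(4)[of dual_unit v] module_isos_zero[OF V W h]
      by (simp add: ker_dual_def)
  qed
  ultimately show ?thesis
    using S1 hD(2) by (auto simp: dual_basis_def)
qed

section \<open>The standard basis of a tuple module\<close>

text \<open>
  The last \<open>m\<close> coordinates of a tuple are multiples of \<open>1#\<close>, so in these positions the entry
  \<open>1#\<close> takes the place of \<open>1\<close>.
\<close>

definition unit_tuple :: "nat \<Rightarrow> nat \<Rightarrow> nat \<Rightarrow> nat \<Rightarrow> dual" where
  "unit_tuple n m i = (\<lambda>j\<in>{1..n+m}. if j = i then if i \<le> n then (1, 0) else dual_unit else (0, 0))"

lemma inj_on_unit_tuple: "inj_on (unit_tuple n m) {1..n+m}"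
proof (rule inj_onI)
  fix i j assume "i \<in> {1..n+m}" "j \<in> {1..n+m}" "unit_tuple n m i = unit_tuple n m j"
  then have "i \<in> {1..n+m}" "unit_tuple n m i i = unit_tuple n m j i"
    by simp_all
  then show "i = j"
    by (auto simp: unit_tuple_def dual_unit_def split: if_splits)
qed

lemma unit_tuple_closed: "unit_tuple n m i \<in> carrier (dual_tuples n m)"
  by (auto simp: unit_tuple_def dual_unit_def)

text \<open>
  In a position \<open>i > n\<close> a scalar is multiplied by \<open>1#\<close>, which moves its real part to the second
  component and annihilates the rest.
\<close>

lemma finsum_unit_tuple:
  assumes "finite K" and "K \<subseteq> {1..n+m}" and "i \<in> {1..n+m}"
  shows "(\<Oplus>\<^bsub>dual_tuples n m\<^esub>v\<in>unit_tuple n m ` K. c v \<odot>\<^bsub>dual_tuples n m\<^esub> v) i =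
    (if i \<notin> K then (0, 0) else if i \<le> n then c (unit_tuple n m i)
     else (0, fst (c (unit_tuple n m i))))"
proof -
  interpret module dual_ring "dual_tuples n m" by (rule module_dual_tuples)
  have closed: "c v \<odot>\<^bsub>dual_tuples n m\<^esub> v \<in> carrier (dual_tuples n m)" if "v \<in> unit_tuple n m ` K"
    for v K
    using that unit_tuple_closed by (intro smult_closed) (auto simp del: carrier_dual_tuples)
  have smult_unit: "(r \<odot>\<^bsub>dual_tuples n m\<^esub> unit_tuple n m k) i =
      (if i = k then if i \<le> n then r else (0, fst r) else (0, 0))" for r k
    using assms(3) by (simp add: unit_tuple_def dual_unit_def)
  from assms(1,2) show ?thesis
  proof (induction K rule: finite_induct)
    case empty
    then show ?case using assms(3) by simp
  next
    case (insert k K)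
    let ?e = "unit_tuple n m"
    let ?S = "\<Oplus>\<^bsub>dual_tuples n m\<^esub>v\<in>?e ` K. c v \<odot>\<^bsub>dual_tuples n m\<^esub> v"
    have IH: "?S i = (if i \<notin> K then (0, 0) else if i \<le> n then c (?e i) else (0, fst (c (?e i))))"
      using insert.IH insert.prems by blast
    have "?e k \<notin> ?e ` K"
      using insert.hyps insert.prems by (subst inj_on_image_mem_iff[OF inj_on_unit_tuple]) auto
    then have "(\<Oplus>\<^bsub>dual_tuples n m\<^esub>v\<in>?e ` insert k K. c v \<odot>\<^bsub>dual_tuples n m\<^esub> v) =
        c (?e k) \<odot>\<^bsub>dual_tuples n m\<^esub> ?e k \<oplus>\<^bsub>dual_tuples n m\<^esub> ?S"
      unfolding image_insert using insert.hyps(1) closed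
      by (intro M.finsum_insert) (auto simp del: carrier_dual_tuples smult_dual_tuples)
    moreover have "(x \<oplus>\<^bsub>dual_tuples n m\<^esub> y) i = (fst (x i) + fst (y i), snd (x i) + snd (y i))" for x y
      using assms(3) by simp
    ultimately show ?case
      using IH insert.hyps(2) by (simp add: smult_unit del: add_dual_tuples smult_dual_tuples)
  qed
qed

lemma dual_basis_dual_tuples:
  "dual_basis (dual_tuples n m) (unit_tuple n m ` {1..n}) (unit_tuple n m ` {n+1..n+m})"
proof -
  let ?T = "dual_tuples n m" and ?e = "unit_tuple n m"
  interpret module dual_ring ?T by (rule module_dual_tuples)
  have comb: "dual_combination ?T (?e ` I) c (?e ` J) d i =
      (if i \<in> I then c (?e i) else if i \<in> J then (0, d (?e i)) else (0, 0))"
    if "I \<subseteq> {1..n}" "J \<subseteq> {n+1..n+m}" "i \<in> {1..n+m}" for I J c d i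
  proof -
    have "finite I" "finite J" "I \<subseteq> {1..n+m}" "J \<subseteq> {1..n+m}"
      using that by (auto intro: finite_subset)
    then show ?thesis
      using that unfolding dual_combination_def add_dual_tuples
      by (auto simp: finsum_unit_tuple dual_of_real_def simp del: smult_dual_tuples)
  qed
  have "dual_independent ?T (?e ` {1..n}) (?e ` {n+1..n+m})"
    unfolding dual_independent_def
  proof (intro allI impI)
    fix A B c d
    assume "finite A" "A \<subseteq> ?e ` {1..n}" "finite B" "B \<subseteq> ?e ` {n+1..n+m}"
      and zero: "dual_combination ?T A c B d = \<zero>\<^bsub>?T\<^esub>"
    then obtain I J where IJ: "I \<subseteq> {1..n}" "A = ?e ` I" "J \<subseteq> {n+1..n+m}" "B = ?e ` J"
      by (metis subset_image_iff)
    have coord: "(if i \<in> I then c (?e i) else if i \<in> J then (0, d (?e i)) else (0, 0)) = (0, 0)"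
      if "i \<in> {1..n+m}" for i
      using fun_cong[OF zero, of i] comb[OF IJ(1,3) that] that IJ by simp
    have "c (?e i) = (0, 0)" if "i \<in> I" for i
      using coord[of i] IJ(1) that by auto
    moreover have "d (?e i) = 0" if "i \<in> J" for i
    proof -
      have "i \<in> {1..n+m}" "i \<notin> I" using IJ(1,3) that by fastforce+
      with coord[of i] that show ?thesis by simp
    qed
    ultimately show "(\<forall>v\<in>A. c v = \<zero>\<^bsub>dual_ring\<^esub>) \<and> (\<forall>w\<in>B. d w = 0)"
      using IJ by auto
  qed
  moreover have "dual_spanning ?T (?e ` {1..n}) (?e ` {n+1..n+m})"
    unfolding dual_spanning_def
  proof
    fix x assume x: "x \<in> carrier ?T"
    define k where "k = inv_into {1..n+m} ?e"
    have k: "k (?e i) = i" if "i \<in> {1..n+m}" for i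
      using that inj_on_unit_tuple[of n m] by (simp add: k_def)
    let ?y = "dual_combination ?T (?e ` {1..n}) (x \<circ> k) (?e ` {n+1..n+m}) (snd \<circ> x \<circ> k)"
    have "x i = ?y i" for i
    proof (cases "i \<in> {1..n+m}")
      case True
      then show ?thesis
        using x k[OF True] comb[OF order_refl order_refl True] by (auto simp: prod_eq_iff)
    next
      case False
      then have "?y i = undefined" unfolding dual_combination_def add_dual_tuples by auto
      with False x show ?thesis by (simp add: extensional_def)
    qed
    then show "\<exists>A B c d. finite A \<and> A \<subseteq> ?e ` {1..n} \<and> finite B \<and> B \<subseteq> ?e ` {n+1..n+m} \<and>
        x = dual_combination ?T A c B d"
      by (intro exI[of _ "?e ` {1..n}"] exI[of _ "?e ` {n+1..n+m}"] exI[of _ "x \<circ> k"]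
          exI[of _ "snd \<circ> x \<circ> k"]) auto
  qed
  ultimately show ?thesis
    using unit_tuple_closed
    by (auto simp: dual_basis_def ker_dual_def unit_tuple_def dual_unit_def fun_eq_iff)
qed

section \<open>Bases of a given size and isomorphisms with tuples\<close>

text \<open>
  The bijections \<open>\<sigma>\<close> and \<open>\<tau>\<close> number the two parts of the basis by the two ranges of positions; the
  isomorphism is constructed from the tuples to \<open>V\<close>, as the combination with given coordinates.
\<close>

lemma dual_basis_imp_isomorphic:
  assumes V: "Module.module dual_ring V" and basis: "dual_basis V S1 S2"
    and fin: "finite S1" "finite S2"
  shows "modules_isomorphic dual_ring V (dual_tuples (card S1) (card S2))"
proof -
  define n m where "n = card S1" and "m = card S2"
  let ?T = "dual_tuples n m"
  interpret V: module dual_ring V by fact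
  interpret T: module dual_ring ?T by (rule module_dual_tuples)
  have S1: "S1 \<subseteq> carrier V" and S2: "S2 \<subseteq> carrier V" and ker: "S2 \<subseteq> ker_dual V"
    using basis by (auto simp: dual_basis_def ker_dual_def)
  have "card S1 = card {1..n}"
    by (simp add: n_def)
  from finite_same_card_bij[OF fin(1) finite_atLeastAtMost this]
  obtain \<sigma> where \<sigma>: "bij_betw \<sigma> S1 {1..n}"
    by (rule exE)
  have "card S2 = card {n+1..n+m}"
    by (simp add: m_def)
  from finite_same_card_bij[OF fin(2) finite_atLeastAtMost this]
  obtain \<tau> where \<tau>: "bij_betw \<tau> S2 {n+1..n+m}"
    by (rule exE)
  have \<sigma>_in: "\<sigma> v \<in> {1..n}" if "v \<in> S1" for v
    using \<sigma> that by (auto simp: bij_betw_def)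
  have \<tau>_in: "\<tau> w \<in> {n+1..n+m}" if "w \<in> S2" for w
    using \<tau> that by (auto simp: bij_betw_def)
  define g where "g x = dual_combination V S1 (x \<circ> \<sigma>) S2 (snd \<circ> x \<circ> \<tau>)" for x
  have g_closed: "g x \<in> carrier V" for x
    unfolding g_def by (rule dual_combination_closed[OF V S1 S2])
  have g_add: "g (x \<oplus>\<^bsub>?T\<^esub> y) = g x \<oplus>\<^bsub>V\<^esub> g y" for x y
  proof -
    have "g (x \<oplus>\<^bsub>?T\<^esub> y) = dual_combination V S1 (\<lambda>v. (x \<circ> \<sigma>) v \<oplus>\<^bsub>dual_ring\<^esub> (y \<circ> \<sigma>) v)
        S2 (\<lambda>w. (snd \<circ> x \<circ> \<tau>) w + (snd \<circ> y \<circ> \<tau>) w)"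
      unfolding g_def
    proof (rule dual_combination_cong[OF V S1 S2])
      fix v assume "v \<in> S1"
      from \<sigma>_in[OF this] show "((x \<oplus>\<^bsub>?T\<^esub> y) \<circ> \<sigma>) v = (x \<circ> \<sigma>) v \<oplus>\<^bsub>dual_ring\<^esub> (y \<circ> \<sigma>) v"
        by simp
    next
      fix w assume "w \<in> S2"
      from \<tau>_in[OF this] show "(snd \<circ> (x \<oplus>\<^bsub>?T\<^esub> y) \<circ> \<tau>) w = (snd \<circ> x \<circ> \<tau>) w + (snd \<circ> y \<circ> \<tau>) w"
        by simp
    qed
    then show ?thesis
      unfolding g_def dual_combination_add[OF V S1 S2] .
  qed
  have g_smult: "g (c \<odot>\<^bsub>?T\<^esub> x) = c \<odot>\<^bsub>V\<^esub> g x" if x: "x \<in> carrier ?T" for c x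
  proof -
    have "g (c \<odot>\<^bsub>?T\<^esub> x) = dual_combination V S1 (\<lambda>v. c \<otimes>\<^bsub>dual_ring\<^esub> (x \<circ> \<sigma>) v)
        S2 (\<lambda>w. fst c * (snd \<circ> x \<circ> \<tau>) w)"
      unfolding g_def
    proof (rule dual_combination_cong[OF V S1 S2])
      fix v assume "v \<in> S1"
      from \<sigma>_in[OF this] show "((c \<odot>\<^bsub>?T\<^esub> x) \<circ> \<sigma>) v = c \<otimes>\<^bsub>dual_ring\<^esub> (x \<circ> \<sigma>) v"
        by simp
    next
      fix w assume "w \<in> S2"
      from \<tau>_in[OF this] x show "(snd \<circ> (c \<odot>\<^bsub>?T\<^esub> x) \<circ> \<tau>) w = fst c * (snd \<circ> x \<circ> \<tau>) w"
        by simp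
    qed
    then show ?thesis
      unfolding g_def dual_combination_smult[OF V S1 fin(1) ker fin(2)] .
  qed
  have inj: "x = \<zero>\<^bsub>?T\<^esub>" if x: "x \<in> carrier ?T" and gx: "g x = \<zero>\<^bsub>V\<^esub>" for x
  proof -
    have coeffs: "(\<forall>v\<in>S1. (x \<circ> \<sigma>) v = \<zero>\<^bsub>dual_ring\<^esub>) \<and> (\<forall>w\<in>S2. (snd \<circ> x \<circ> \<tau>) w = 0)"
      using basis gx fin unfolding g_def dual_basis_def dual_independent_def by blast
    have "x i = (0, 0)" if i: "i \<in> {1..n+m}" for i
    proof (cases "i \<le> n")
      case True
      then have "i \<in> \<sigma> ` S1"
        using i bij_betw_imp_surj_on[OF \<sigma>] by simp
      then obtain v where "v \<in> S1" "i = \<sigma> v"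
        by blast
      then show ?thesis using coeffs by simp
    next
      case False
      then have "i \<in> \<tau> ` S2"
        using i bij_betw_imp_surj_on[OF \<tau>] by simp
      then obtain w where "w \<in> S2" "i = \<tau> w"
        by blast
      then show ?thesis using coeffs x i False by (simp add: prod_eq_iff)
    qed
    with x show ?thesis by (auto simp: fun_eq_iff extensional_def)
  qed
  have surj: "v \<in> g ` carrier ?T" if v_in: "v \<in> carrier V" for v
  proof -
    obtain A B c d where AB: "finite A" "A \<subseteq> S1" "finite B" "B \<subseteq> S2"
        and v: "v = dual_combination V A c B d"
      using basis v_in unfolding dual_basis_def dual_spanning_def by blast
    \<comment> \<open>The coordinates of \<open>v\<close>, zero at the basis vectors outside of \<open>A\<close> and \<open>B\<close>.\<close>
    define x where "x = (\<lambda>i\<in>{1..n+m}. if i \<le> n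
        then if inv_into S1 \<sigma> i \<in> A then c (inv_into S1 \<sigma> i) else (0, 0)
        else (0, if inv_into S2 \<tau> i \<in> B then d (inv_into S2 \<tau> i) else 0))"
    have x\<sigma>: "(x \<circ> \<sigma>) u = (if u \<in> A then c u else (0, 0))" if "u \<in> S1" for u
      using \<sigma>_in[OF that] that bij_betw_imp_inj_on[OF \<sigma>] by (simp add: x_def)
    have x\<tau>: "(snd \<circ> x \<circ> \<tau>) u = (if u \<in> B then d u else 0)" if "u \<in> S2" for u
      using \<tau>_in[OF that] that bij_betw_imp_inj_on[OF \<tau>] by (simp add: x_def)
    have "v = dual_combination V S1 (\<lambda>v. if v \<in> A then c v else (0, 0)) S2 (\<lambda>w. if w \<in> B then d w else 0)"
      unfolding v by (rule dual_combination_extend[OF V S1 fin(1) S2 fin(2) AB(2,4)])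
    also have "\<dots> = g x"
      unfolding g_def by (intro dual_combination_cong[OF V S1 S2]) (simp_all only: x\<sigma> x\<tau>)
    finally have "v = g x" .
    moreover have "x \<in> carrier ?T" by (simp add: x_def)
    ultimately show ?thesis by (rule image_eqI)
  qed
  have "g \<in> hom (add_monoid ?T) (add_monoid V)"
    by (rule homI) (simp_all only: monoid.simps partial_object.simps g_closed g_add)
  then have "group_hom (add_monoid ?T) (add_monoid V) g"
    by (intro group_hom.intro group_hom_axioms.intro T.M.a_group V.M.a_group)
  from group_hom.iso_iff[OF this] have "g \<in> iso (add_monoid ?T) (add_monoid V)"
    using inj surj by (simp only: monoid.simps partial_object.simps) blast
  then have "g \<in> module_isos dual_ring ?T V"
    using g_smult by (simp add: module_isos_def del: carrier_dual_tuples smult_dual_tuples)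
  from module_isos_inv[OF module_dual_tuples this] show ?thesis
    unfolding modules_isomorphic_def n_def m_def by blast
qed

lemma isomorphic_imp_dual_basis:
  assumes "Module.module dual_ring V" and "modules_isomorphic dual_ring V (dual_tuples n m)"
  obtains S1 S2 where "dual_basis V S1 S2" "finite S1" "finite S2" "card S1 = n" "card S2 = m"
proof -
  let ?e = "unit_tuple n m"
  obtain h where h: "h \<in> module_isos dual_ring V (dual_tuples n m)"
    using assms(2) by (auto simp: modules_isomorphic_def)
  define g where "g = inv_into (carrier V) h"
  have g: "g \<in> module_isos dual_ring (dual_tuples n m) V"
    unfolding g_def using assms(1) h by (rule module_isos_inv)
  have "?e ` {1..n+m} \<subseteq> carrier (dual_tuples n m)"
    using unit_tuple_closed by blast
  then have inj: "inj_on (g \<circ> ?e) {1..n+m}"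
    using module_isosD(1)[OF g] inj_on_unit_tuple
    by (metis bij_betw_def comp_inj_on inj_on_subset)
  have "dual_basis V (g ` ?e ` {1..n}) (g ` ?e ` {n+1..n+m})"
    by (rule module_isos_dual_basis[OF module_dual_tuples assms(1) g dual_basis_dual_tuples])
  moreover have "card ((g \<circ> ?e) ` {1..n}) = n" "card ((g \<circ> ?e) ` {n+1..n+m}) = m"
    by (subst card_image; auto intro: inj_on_subset[OF inj])+
  ultimately show thesis
    by (intro that[of "g ` ?e ` {1..n}" "g ` ?e ` {n+1..n+m}"]) (simp_all add: image_comp)
qed

text \<open>
  The rank inequalities hold for the isomorphism between the two tuple modules that passes through
  \<open>V\<close>, and for its inverse.
\<close>

lemma isomorphic_dual_tuples_unique:
  assumes V: "Module.module dual_ring V"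
    and "modules_isomorphic dual_ring V (dual_tuples n m)"
    and "modules_isomorphic dual_ring V (dual_tuples n' m')"
  shows "n = n'" and "m = m'"
proof -
  have le: "a \<le> a' \<and> a + b \<le> a' + b'"
    if iso: "modules_isomorphic dual_ring V (dual_tuples a b)"
      "modules_isomorphic dual_ring V (dual_tuples a' b')" for a b a' b'
  proof -
    obtain h k where "h \<in> module_isos dual_ring V (dual_tuples a b)"
        "k \<in> module_isos dual_ring V (dual_tuples a' b')"
      using iso unfolding modules_isomorphic_def by blast
    then have "k \<circ> inv_into (carrier V) h \<in> module_isos dual_ring (dual_tuples a b) (dual_tuples a' b')"
      using module_isos_inv[OF V] module_isos_comp by blast
    then show ?thesis using dual_tuples_isos_rank_le by blast
  qed
  show "n = n'" "m = m'" using le[OF assms(2,3)] le[OF assms(3,2)] by auto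
qed

theorem proposition1p2:
  fixes V :: "(dual, 'v, 'x) module_scheme" and n m :: nat
  assumes "Module.module dual_ring V"
    and "n + m \<noteq> 0"
  shows "modules_isomorphic dual_ring V (dual_tuples n m) \<longleftrightarrow>
         dual_finite_dimensional V \<and> dual_dim V = (n, m)"
proof -
  let ?has_dim = "\<lambda>p. \<exists>S1 S2. dual_basis V S1 S2 \<and> finite S1 \<and> finite S2 \<and> p = (card S1, card S2)"
  have iff: "?has_dim (a, b) \<longleftrightarrow> modules_isomorphic dual_ring V (dual_tuples a b)" for a b
    using dual_basis_imp_isomorphic[OF assms(1)] isomorphic_imp_dual_basis[OF assms(1)]
    by (metis prod.inject)
  then have dim: "dual_dim V = (a, b)" if "?has_dim (a, b)" for a b
    unfolding dual_dim_def
    using that isomorphic_dual_tuples_unique[OF assms(1)]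
    by (intro the_equality) (auto simp only: split_paired_all)
  show ?thesis
  proof
    assume "modules_isomorphic dual_ring V (dual_tuples n m)"
    then have "?has_dim (n, m)" by (simp only: iff)
    with dim show "dual_finite_dimensional V \<and> dual_dim V = (n, m)"
      unfolding dual_finite_dimensional_def by blast
  next
    assume fd: "dual_finite_dimensional V \<and> dual_dim V = (n, m)"
    then obtain a b where ab: "?has_dim (a, b)"
      unfolding dual_finite_dimensional_def by blast
    with dim fd have "(a, b) = (n, m)" by metis
    with ab show "modules_isomorphic dual_ring V (dual_tuples n m)" by (simp only: iff)
  qed
qed

end
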